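(* For any $d \in \mathbb{N}$, any finite (not necessarily abelian) group $G$ and any functions $w_1, \dots, w_{2d} : G \to [0, \infty)$ with non-empty support, we have \[ S_{2d}(w_1, \dots, w_{2d}) \leq \prod_{i=1}^{2d} S_{2d}(w_i)^{1/(2d)}. \]
   Context: $\mathbb{N}$ denotes the positive integers. The group operation of $G$ is written multiplicatively and $1$ denotes the identity element of $G$. For functions $w_1, \dots, w_{2d} : G \to [0,\infty)$ with finite, non-empty supports, \[ S_{2d}(w_1, \dots, w_{2d}) = \sum_{a_1, \dots, a_{2d} \in G} w_1(a_1) \cdots w_{2d}(a_{2d})\, \mathbf{1}_{a_1 a_2^{-1}a_3 a_4^{-1} \cdots a_{2d-1}a_{2d}^{-1} = 1}, \] where $\mathbf{1}_P$ equals $1$ if the condition $P$ holds and $0$ otherwise. For each $1 \leq i \leq 2d$, $S_{2d}(w_i)$ denotes $S_{2d}(w_i, \dots, w_i)$, with $w_i$ repeated $2d$ times. *)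

theory Defs
  imports "HOL-Analysis.Infinite_Sum" "HOL-Algebra.Group"
begin

text \<open>
  The ordered product \<open>a\<^sub>1 a\<^sub>2\<inverse> a\<^sub>3 a\<^sub>4\<inverse> \<dots> a\<^sub>2\<^sub>d\<^sub>-\<^sub>1 a\<^sub>2\<^sub>d\<inverse>\<close>, defined by recursion on \<open>d\<close> since
  \<open>G\<close> need not be commutative.
\<close>

primrec alt_prod :: "('g, 'm) monoid_scheme \<Rightarrow> nat \<Rightarrow> (nat \<Rightarrow> 'g) \<Rightarrow> 'g" where
  "alt_prod G 0 a = \<one>\<^bsub>G\<^esub>"
| "alt_prod G (Suc d) a =
     alt_prod G d a \<otimes>\<^bsub>G\<^esub> a (2 * d + 1) \<otimes>\<^bsub>G\<^esub> inv\<^bsub>G\<^esub> (a (2 * d + 2))"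

text \<open>
  \<open>S2 G d w\<close> is \<open>S\<^sub>2\<^sub>d(w\<^sub>1, \<dots>, w\<^sub>2\<^sub>d)\<close>: the argument \<open>d\<close> is half the number of weights. Tuples
  \<open>(a\<^sub>1, \<dots>, a\<^sub>2\<^sub>d)\<close> are extensional functions on \<open>{1..2 * d}\<close>. The sum over all of \<open>G\<close> is an \<open>infsum\<close>
  so that it has its intended value also for finitely supported weights on an infinite group,
  where \<open>sum\<close> would be \<open>0\<close> by convention; for finite \<open>G\<close> the two agree.
\<close>

definition S2 :: "('g, 'm) monoid_scheme \<Rightarrow> nat \<Rightarrow> (nat \<Rightarrow> 'g \<Rightarrow> real) \<Rightarrow> real" where
  "S2 G d w =
     (\<Sum>\<^sub>\<infinity>a \<in> {1..2 * d} \<rightarrow>\<^sub>E carrier G.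
        (\<Prod>i\<in>{1..2 * d}. w i (a i)) * of_bool (alt_prod G d a = \<one>\<^bsub>G\<^esub>))"

end

theory Submission
  imports Defs "HOL-Analysis.Convex"
begin

text \<open>
  The proof is a chessboard estimate. Putting \<open>f\<^sub>i = w\<^sub>i\<close> for odd \<open>i\<close> and \<open>f\<^sub>i(x) = w\<^sub>i(x\<inverse>)\<close> for even
  \<open>i\<close>, the sum is the convolution \<open>T(f\<^sub>1, \<dots>, f\<^sub>2\<^sub>d)\<close> of the \<open>f\<^sub>i\<close> evaluated at the identity. It is
  invariant under cyclic rotation, and Cauchy-Schwarz applied to the two halves bounds it by the
  geometric mean of the values at two words that are symmetric under reflection composed with
  inversion. Among all words in the \<open>f\<^sub>i\<close> and their inversions, let one maximise the ratio of the
  two sides of the inequality. By Cauchy-Schwarz its reflections are maximisers too, so alternately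
  reflecting and rotating yields a maximiser of the form \<open>f, f\<tilde>, f, f\<tilde>, \<dots>\<close>, where \<open>f\<tilde>(x) = f(x\<inverse>)\<close>,
  and there the ratio is \<open>1\<close>.
\<close>

section \<open>The chessboard estimate\<close>

definition alternating :: "('l \<Rightarrow> 'l) \<Rightarrow> nat \<Rightarrow> 'l \<Rightarrow> 'l list" where
  "alternating flip n x = map (\<lambda>i. (flip ^^ i) x) [0..<n]"

lemma funpow_involution:
  assumes "\<And>x. flip (flip x) = x"
  shows "(flip ^^ i) x = (if even i then x else flip x)"
  by (induction i) (auto simp: assms)

lemma rotate1_alternating:
  assumes "\<And>x. flip (flip x) = x"
  shows "rotate1 (alternating flip (2 * n) x) = alternating flip (2 * n) (flip x)"
proof (rule nth_equalityI)
  fix i assume "i < length (rotate1 (alternating flip (2 * n) x))"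
  then have i: "i < 2 * n" by (simp add: alternating_def)
  \<comment> \<open>The parity survives the wrap-around at the last index because the length
    \<open>2 * n\<close> is even.\<close>
  have "even (Suc i mod (2 * n)) \<longleftrightarrow> odd i"
    by (subst dvd_mod_iff) auto
  with i show "rotate1 (alternating flip (2 * n) x) ! i = alternating flip (2 * n) (flip x) ! i"
    by (simp add: alternating_def nth_rotate1 funpow_involution assms)
qed (simp add: alternating_def)

lemma prod_list_map_pos:
  fixes f :: "'l \<Rightarrow> real"
  assumes "\<And>x. x \<in> set xs \<Longrightarrow> f x > 0"
  shows "prod_list (map f xs) > 0"
  using assms by (induction xs) auto

lemma prod_list_map_flip_rev:
  fixes f :: "'l \<Rightarrow> real"
  assumes "\<And>x. x \<in> set xs \<Longrightarrow> f (flip x) = f x"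
  shows "prod_list (map f (map flip (rev xs))) = prod_list (map f xs)"
  using assms by (induction xs) auto

text \<open>The entry after the junction is the flip of the one before it, and the second half
  mirrors the first. So an alternating run of length \<open>k\<close> at the end of
  \<open>xs\<close> grows to one of length \<open>2 * k\<close> around the junction.\<close>

lemma reflected_nth_Suc:
  assumes flip: "\<And>x. flip (flip x) = x"
    and "length xs = d"
    and run: "\<And>i. d \<le> i + k \<Longrightarrow> Suc i < d \<Longrightarrow> xs ! Suc i = flip (xs ! i)"
    and i: "d \<le> i + k" "Suc i < d + k" "k \<le> d"
  shows "(xs @ map flip (rev xs)) ! Suc i = flip ((xs @ map flip (rev xs)) ! i)"
proof -
  consider "Suc i < d" | "Suc i = d" | "d \<le> i" by linarith
  then show ?thesis
  proof cases
    case 3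
    \<comment> \<open>The step from \<open>i\<close> to \<open>Suc i\<close> in the second half
      mirrors the step from \<open>j\<close> to \<open>Suc j\<close>, traversed backwards.\<close>
    define j where "j = 2 * d - 2 - i"
    have j: "d \<le> j + k" "Suc j < d" using 3 i by (auto simp: j_def)
    have "d - Suc (Suc i - d) = j" "d - Suc (i - d) = Suc j"
      using 3 i by (auto simp: j_def)
    then show ?thesis
      using 3 i assms(2) run[OF j] by (simp add: nth_append rev_nth flip)
  next
    case 2
    then show ?thesis using assms(2) by (auto simp: nth_append rev_nth)
  qed (use assms run in \<open>auto simp: nth_append\<close>)
qed

text \<open>Finitely many labels leave finitely many words of length \<open>2 * d\<close>, so a
  maximiser exists. Only \<open>rot\<close> and \<open>refl\<close> relate the values of
  \<open>T\<close> at different words.\<close>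

lemma chessboard:
  fixes T :: "'l list \<Rightarrow> real"
  assumes d: "d \<ge> 1"
    and finL: "finite L"
    and flip: "\<And>x. flip (flip x) = x" "\<And>x. x \<in> L \<Longrightarrow> flip x \<in> L"
    and nonneg: "\<And>u. set u \<subseteq> L \<Longrightarrow> T u \<ge> 0"
    and rot: "\<And>u. T (rotate1 u) = T u"
    and refl: "\<And>xs ys. T (xs @ ys) ^ 2 \<le> T (xs @ map flip (rev xs)) * T (map flip (rev ys) @ ys)"
    and pos: "\<And>x. x \<in> L \<Longrightarrow> T (alternating flip (2 * d) x) > 0"
    and u: "set u \<subseteq> L" "length u = 2 * d"
  shows "T u ^ (2 * d) \<le> prod_list (map (\<lambda>x. T (alternating flip (2 * d) x)) u)"
proof -
  define W where "W = {u. set u \<subseteq> L \<and> length u = 2 * d}"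
  define A where "A x = T (alternating flip (2 * d) x)" for x
  define P where "P u = prod_list (map A u)" for u
  \<comment> \<open>The ratio of the two sides is taken to the power \<open>2 * d\<close>, which
    avoids roots.\<close>
  define r where "r u = T u ^ (2 * d) / P u" for u
  have A_flip: "A (flip x) = A x" for x
    unfolding A_def by (metis rot rotate1_alternating flip(1))
  have P_pos: "P u > 0" if "set u \<subseteq> L" for u
    unfolding P_def by (rule prod_list_map_pos) (use that pos in \<open>auto simp: A_def\<close>)
  have P_append: "P (xs @ ys) = P xs * P ys" for xs ys by (simp add: P_def)
  have P_flip: "P (map flip (rev xs)) = P xs" for xs
    unfolding P_def by (rule prod_list_map_flip_rev) (rule A_flip)
  have P_rot: "P (rotate1 u) = P u" for u by (cases u) (auto simp: P_def)
  have r_alt: "r (alternating flip (2 * d) x) = 1" if "x \<in> L" for x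
  proof -
    have "map A (alternating flip (2 * d) x) = replicate (2 * d) (A x)"
      by (rule nth_equalityI) (auto simp: alternating_def funpow_involution flip A_flip)
    then show ?thesis
      using pos[OF that] by (simp add: r_def P_def A_def)
  qed
  have finW: "finite W" unfolding W_def using finite_lists_length_eq[OF finL] .
  define M where "M = Max (r ` W)"
  have r_le: "r v \<le> M" if "v \<in> W" for v
    unfolding M_def using finW that by auto
  have uW: "u \<in> W" using u by (simp add: W_def)
  have "u \<noteq> []" using d u by auto
  then have hdL: "hd u \<in> L" using u by auto
  have set_alt: "alternating flip (2 * d) x \<in> W" if "x \<in> L" for x
    using that flip by (auto simp: W_def alternating_def funpow_involution)
  have M1: "M \<ge> 1" using r_le[OF set_alt[OF hdL]] r_alt[OF hdL] by simp
  \<comment> \<open>Since \<open>P ?v * P ?w = P (xs @ ys) ^ 2\<close>, Cauchy-Schwarz reads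
    \<open>M ^ 2 \<le> r ?v * r ?w\<close>. Bounding the last factor by \<open>M\<close> and
    cancelling \<open>M > 0\<close> leaves \<open>M \<le> r ?v\<close>.\<close>
  have reflect: "xs @ map flip (rev xs) \<in> W \<and> r (xs @ map flip (rev xs)) = M"
    if W: "xs @ ys \<in> W" "r (xs @ ys) = M" "length xs = d" for xs ys
  proof -
    let ?v = "xs @ map flip (rev xs)" and ?w = "map flip (rev ys) @ ys"
    have vw: "?v \<in> W" "?w \<in> W" using W flip(2) by (auto simp: W_def)
    have "M ^ 2 = (T (xs @ ys) ^ 2) ^ (2 * d) / P (xs @ ys) ^ 2"
      by (simp flip: W(2) add: r_def power_divide power_mult[symmetric] mult.commute)
    also have "\<dots> \<le> (T ?v * T ?w) ^ (2 * d) / P (xs @ ys) ^ 2"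
      by (intro divide_right_mono power_mono refl) auto
    also have "\<dots> = r ?v * r ?w"
      by (simp add: r_def P_append P_flip power_mult_distrib power2_eq_square)
    also have "\<dots> \<le> r ?v * M"
    proof (rule mult_left_mono[OF r_le[OF vw(2)]])
      show "r ?v \<ge> 0"
        using vw(1) P_pos nonneg unfolding r_def W_def by (simp add: less_imp_le)
    qed
    finally have "M \<le> r ?v" using M1 by (simp add: power2_eq_square)
    with r_le[OF vw(1)] vw show ?thesis by simp
  qed
  have half: "xs @ map flip (rev xs) \<in> W \<and> r (xs @ map flip (rev xs)) = M"
    if "v \<in> W" "r v = M" "xs = take d v" for v xs
    using reflect[of xs "drop d v"] that by (simp add: W_def)
  \<comment> \<open>Some maximiser has a first half ending in an alternating run of length
    \<open>k\<close>; for \<open>k = 1\<close> the run condition is vacuous.\<close>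
  have "\<exists>v\<in>W. r v = M \<and> (\<forall>i. d \<le> i + k \<longrightarrow> Suc i < d \<longrightarrow> v ! Suc i = flip (v ! i))"
    if "1 \<le> k" "k \<le> d" for k
    using that
  proof (induction k rule: dec_induct)
    case base
    have "M \<in> r ` W" unfolding M_def using finW uW by (intro Max_in) auto
    then show ?case by auto
  next
    case (step k)
    then obtain v where v: "v \<in> W" "r v = M"
      "\<And>i. d \<le> i + k \<Longrightarrow> Suc i < d \<Longrightarrow> v ! Suc i = flip (v ! i)" by auto
    define xs where "xs = take d v"
    define v' where "v' = xs @ map flip (rev xs)"
    have v': "v' \<in> W" "r v' = M" using half[OF v(1,2) xs_def] by (auto simp: v'_def)
    have len: "length xs = d" "length v' = 2 * d"
      using v(1) v'(1) by (auto simp: xs_def W_def)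
    have run: "v' ! Suc i = flip (v' ! i)" if "d \<le> i + k" "Suc i < d + k" for i
      unfolding v'_def
      by (rule reflected_nth_Suc[where d = d and k = k]) (use that v step len flip in \<open>auto simp: xs_def\<close>)
    \<comment> \<open>Counting from 0, positions \<open>d - k\<close> to \<open>d + k - 1\<close> of
      \<open>v'\<close> alternate. Rotation shifts this run left by one, so, as
      \<open>k \<ge> 1\<close>, it covers the last \<open>k + 1\<close> entries of the first
      half.\<close>
    show ?case
    proof (intro bexI[of _ "rotate1 v'"] conjI allI impI)
      show "rotate1 v' \<in> W" using v' by (simp add: W_def)
      show "r (rotate1 v') = M" using v' by (simp add: r_def rot P_rot)
      fix i assume "d \<le> i + Suc k" "Suc i < d"
      then show "rotate1 v' ! Suc i = flip (rotate1 v' ! i)"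
        using run[of "Suc i"] len step by (simp add: nth_rotate1)
    qed
  qed
  from this[of d] d obtain v where v: "v \<in> W" "r v = M"
    "\<And>i. Suc i < d \<Longrightarrow> v ! Suc i = flip (v ! i)" by auto
  \<comment> \<open>The whole first half of \<open>v\<close> now alternates, so one more reflection
    gives a maximiser alternating throughout.\<close>
  define xs where "xs = take d v"
  define v' where "v' = xs @ map flip (rev xs)"
  have v': "v' \<in> W" "r v' = M" using half[OF v(1,2) xs_def] by (auto simp: v'_def)
  have len: "length xs = d" "length v' = 2 * d"
    using v(1) v'(1) by (auto simp: xs_def W_def)
  have run: "v' ! Suc i = flip (v' ! i)" if "Suc i < 2 * d" for i
    unfolding v'_def
    by (rule reflected_nth_Suc[where d = d and k = d]) (use that v len flip in \<open>auto simp: xs_def\<close>)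
  define x where "x = v' ! 0"
  have "v' ! i = (flip ^^ i) x" if "i < 2 * d" for i
    using that by (induction i) (auto simp: run x_def)
  then have "v' = alternating flip (2 * d) x"
    by (intro nth_equalityI) (auto simp: alternating_def len)
  moreover have "x \<in> L"
    using v'(1) d len unfolding W_def x_def by (auto intro!: subsetD[OF _ nth_mem])
  ultimately have "M = 1" using r_alt v'(2) by metis
  then have "r u \<le> 1" using r_le[OF uW] by simp
  then have "T u ^ (2 * d) \<le> P u" using P_pos[OF u(1)] by (simp add: r_def)
  then show ?thesis unfolding P_def A_def .
qed

section \<open>Iterated convolution on a finite group\<close>

text \<open>This sums the products of the values \<open>f\<^sub>i x\<^sub>i\<close> over all ordered
  factorisations of \<open>g\<close> into \<open>x\<^sub>1, ..., x\<^sub>n\<close>; the empty list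
  gives the unit of convolution.\<close>

primrec conv :: "('g, 'm) monoid_scheme \<Rightarrow> ('g \<Rightarrow> real) list \<Rightarrow> 'g \<Rightarrow> real" where
  "conv G [] g = of_bool (g = \<one>\<^bsub>G\<^esub>)"
| "conv G (f # fs) g = (\<Sum>x\<in>carrier G. f x * conv G fs (inv\<^bsub>G\<^esub> x \<otimes>\<^bsub>G\<^esub> g))"

context group
begin

lemma inv_mult_eq_one_iff:
  assumes "x \<in> carrier G" "g \<in> carrier G"
  shows "inv x \<otimes> g = \<one> \<longleftrightarrow> x = g"
  using assms by (metis inv_closed inv_equality inv_inv l_inv)

lemma mult_inv_mult_cancel:
  assumes "x \<in> carrier G" "y \<in> carrier G"
  shows "x \<otimes> (inv x \<otimes> y) = y" "inv x \<otimes> (x \<otimes> y) = y"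
  using assms by (simp_all add: m_assoc[symmetric])

lemma sum_carrier_inv: "(\<Sum>x\<in>carrier G. f (inv x)) = (\<Sum>x\<in>carrier G. f x)"
  by (rule sum.reindex_bij_witness[where i = "\<lambda>x. inv x" and j = "\<lambda>x. inv x"]) auto

lemma sum_carrier_translate:
  assumes "y \<in> carrier G"
  shows "(\<Sum>x\<in>carrier G. f (inv y \<otimes> x)) = (\<Sum>x\<in>carrier G. f x)"
  by (rule sum.reindex_bij_witness[where i = "\<lambda>x. y \<otimes> x" and j = "\<lambda>x. inv y \<otimes> x"])
     (use assms in \<open>auto simp: m_assoc[symmetric]\<close>)

lemma conv_nonneg:
  assumes "\<And>f x. f \<in> set fs \<Longrightarrow> x \<in> carrier G \<Longrightarrow> f x \<ge> 0" "g \<in> carrier G"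
  shows "conv G fs g \<ge> 0"
  using assms by (induction fs arbitrary: g) (auto intro!: sum_nonneg mult_nonneg_nonneg)

text \<open>This is associativity of convolution: the inner variable is translated by
  \<open>y\<close>, then the two sums are swapped.\<close>

lemma conv_append:
  assumes fin: "finite (carrier G)" and g: "g \<in> carrier G"
  shows "conv G (fs @ hs) g = (\<Sum>x\<in>carrier G. conv G fs x * conv G hs (inv x \<otimes> g))"
  using g
proof (induction fs arbitrary: g)
  case Nil
  have "(\<Sum>x\<in>carrier G. conv G [] x * conv G hs (inv x \<otimes> g)) =
        (\<Sum>x\<in>carrier G. if x = \<one> then conv G hs (inv x \<otimes> g) else 0)"
    by (rule sum.cong) auto
  also have "\<dots> = conv G hs g" using fin Nil by simp
  finally show ?case by simp
next
  case (Cons f fs)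
  have "conv G ((f # fs) @ hs) g =
      (\<Sum>y\<in>carrier G. \<Sum>x\<in>carrier G. f y * conv G fs x * conv G hs (inv x \<otimes> (inv y \<otimes> g)))"
    using Cons by (simp add: sum_distrib_left mult.assoc)
  also have "\<dots> = (\<Sum>y\<in>carrier G. \<Sum>x\<in>carrier G.
      f y * conv G fs (inv y \<otimes> x) * conv G hs (inv x \<otimes> g))"
  proof (rule sum.cong[OF HOL.refl])
    fix y assume y: "y \<in> carrier G"
    have "(\<Sum>x\<in>carrier G. f y * conv G fs x * conv G hs (inv x \<otimes> (inv y \<otimes> g))) =
        (\<Sum>x\<in>carrier G. f y * conv G fs x * conv G hs (inv (y \<otimes> x) \<otimes> g))"
      using y Cons.prems by (intro sum.cong) (auto simp: inv_mult_group m_assoc)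
    also have "\<dots> = (\<Sum>x\<in>carrier G.
        f y * conv G fs (inv y \<otimes> x) * conv G hs (inv (y \<otimes> (inv y \<otimes> x)) \<otimes> g))"
      by (rule sum_carrier_translate[OF y, symmetric])
    also have "\<dots> = (\<Sum>x\<in>carrier G. f y * conv G fs (inv y \<otimes> x) * conv G hs (inv x \<otimes> g))"
      using y by (intro sum.cong) (auto simp: m_assoc[symmetric])
    finally show "(\<Sum>x\<in>carrier G. f y * conv G fs x * conv G hs (inv x \<otimes> (inv y \<otimes> g))) = \<dots>" .
  qed
  also have "\<dots> = (\<Sum>x\<in>carrier G. conv G (f # fs) x * conv G hs (inv x \<otimes> g))"
    by (subst sum.swap) (simp add: sum_distrib_right)
  finally show ?case .
qed

lemma conv_append_one:
  assumes "finite (carrier G)"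
  shows "conv G (fs @ hs) \<one> = (\<Sum>x\<in>carrier G. conv G fs x * conv G hs (inv x))"
  using conv_append[OF assms, of \<one>] by simp

text \<open>At the identity, substituting the inverse of \<open>x\<close> exchanges the two factors.
  This trace-like property yields invariance under rotation.\<close>

lemma conv_append_one_commute:
  assumes "finite (carrier G)"
  shows "conv G (fs @ hs) \<one> = conv G (hs @ fs) \<one>"
proof -
  have "conv G (fs @ hs) \<one> = (\<Sum>x\<in>carrier G. conv G fs (inv x) * conv G hs (inv (inv x)))"
    unfolding conv_append_one[OF assms] by (rule sum_carrier_inv[symmetric])
  also have "\<dots> = conv G (hs @ fs) \<one>"
    unfolding conv_append_one[OF assms] by (simp add: mult.commute)
  finally show ?thesis .
qed

lemma conv_singleton:
  assumes "finite (carrier G)" "g \<in> carrier G"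
  shows "conv G [f] g = f g"
proof -
  have "conv G [f] g = (\<Sum>x\<in>carrier G. if x = g then f x else 0)"
    unfolding conv.simps using assms by (intro sum.cong) (auto simp: inv_mult_eq_one_iff)
  then show ?thesis using assms by simp
qed

text \<open>Inversion is an anti-automorphism of the group, so it reverses the order of a
  convolution.\<close>

lemma conv_reflect:
  assumes fin: "finite (carrier G)" and g: "g \<in> carrier G"
    and val: "\<And>l x. x \<in> carrier G \<Longrightarrow> val (flip l) x = val l (inv x)"
  shows "conv G (map val (map flip (rev ls))) g = conv G (map val ls) (inv g)"
  using g
proof (induction ls arbitrary: g)
  case Nil
  then show ?case by simp
next
  case (Cons l ls)
  have "conv G (map val (map flip (rev (l # ls)))) g =
      (\<Sum>x\<in>carrier G. conv G (map val ls) (inv x) * val l (inv (inv x \<otimes> g)))"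
    using Cons by (simp add: conv_append[OF fin] conv_singleton[OF fin] val del: conv.simps)
  also have "\<dots> = (\<Sum>x\<in>carrier G. conv G (map val ls) (inv (g \<otimes> x)) * val l x)"
    by (rule sum.reindex_bij_witness[where i = "\<lambda>x. g \<otimes> x" and j = "\<lambda>x. inv g \<otimes> x"])
       (use Cons.prems in \<open>auto simp: inv_mult_group mult_inv_mult_cancel\<close>)
  also have "\<dots> = conv G (map val (l # ls)) (inv g)"
    using Cons.prems by (auto simp: inv_mult_group mult.commute intro!: sum.cong)
  finally show ?case .
qed

text \<open>The left side is the square of an inner product of the convolution over
  \<open>xs\<close> with the inverted one over \<open>ys\<close>. By \<open>conv_reflect\<close>,
  their squared norms are the values at the reflected words.\<close>

lemma conv_Cauchy_Schwarz:
  assumes fin: "finite (carrier G)"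
    and val: "\<And>l x. x \<in> carrier G \<Longrightarrow> val (flip l) x = val l (inv x)"
  shows "conv G (map val (xs @ ys)) \<one> ^ 2 \<le>
    conv G (map val (xs @ map flip (rev xs))) \<one> * conv G (map val (map flip (rev ys) @ ys)) \<one>"
proof -
  note reflect = conv_reflect[where val = val and flip = flip, OF fin _ val]
  have "conv G (map val (xs @ ys)) \<one> ^ 2 =
      (\<Sum>x\<in>carrier G. conv G (map val xs) x * conv G (map val ys) (inv x)) ^ 2"
    by (simp add: conv_append_one[OF fin])
  also have "\<dots> \<le> (\<Sum>x\<in>carrier G. conv G (map val xs) x ^ 2) *
      (\<Sum>x\<in>carrier G. conv G (map val ys) (inv x) ^ 2)"
    by (rule Cauchy_Schwarz_ineq_sum)
  also have "(\<Sum>x\<in>carrier G. conv G (map val xs) x ^ 2) =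
      conv G (map val (xs @ map flip (rev xs))) \<one>"
    using reflect[of "inv _" xs]
    by (simp add: conv_append_one[OF fin] power2_eq_square del: map_map)
  also have "(\<Sum>x\<in>carrier G. conv G (map val ys) (inv x) ^ 2) =
      conv G (map val (map flip (rev ys) @ ys)) \<one>"
    using reflect[of _ ys]
    by (simp add: conv_append_one[OF fin] power2_eq_square del: map_map)
  finally show ?thesis .
qed

lemma conv_Cons_ge:
  assumes fin: "finite (carrier G)"
    and nonneg: "\<And>h y. h \<in> set (f # fs) \<Longrightarrow> y \<in> carrier G \<Longrightarrow> h y \<ge> 0"
    and x: "x \<in> carrier G" and g: "g \<in> carrier G"
  shows "f x * conv G fs (inv x \<otimes> g) \<le> conv G (f # fs) g"
  unfolding conv.simps
  by (rule member_le_sum[where f = "\<lambda>x. f x * conv G fs (inv x \<otimes> g)", OF x _ fin])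
     (use nonneg g in \<open>auto intro!: mult_nonneg_nonneg conv_nonneg\<close>)

text \<open>All terms are nonnegative, and the factorisation of the identity alternating between
  \<open>x\<close> and its inverse contributes a power of \<open>val l x\<close>. Peeling two
  letters at a time returns to the identity.\<close>

lemma conv_alternating_pos:
  assumes fin: "finite (carrier G)"
    and flip: "\<And>l. flip (flip l) = l"
    and val: "\<And>l x. x \<in> carrier G \<Longrightarrow> val (flip l) x = val l (inv x)"
    and nonneg: "\<And>x. x \<in> carrier G \<Longrightarrow> val l x \<ge> 0"
    and x: "x \<in> carrier G" "val l x > 0"
  shows "conv G (map val (alternating flip (2 * n) l)) \<one> > 0"
proof (induction n)
  case 0
  then show ?case by (simp add: alternating_def)
next
  case (Suc n)
  let ?fs = "map val (alternating flip (2 * n) l)"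
  have nonneg': "h y \<ge> 0" if "h \<in> set (val l # val (flip l) # ?fs)" "y \<in> carrier G" for h y
    using that nonneg by (auto simp: val alternating_def funpow_involution flip split: if_splits)
  have "alternating flip (2 * Suc n) l = l # flip l # alternating flip (2 * n) l"
    by (simp add: alternating_def map_upt_Suc funpow_swap1 flip del: upt_Suc)
  then have eq: "map val (alternating flip (2 * Suc n) l) = val l # val (flip l) # ?fs" by simp
  have "0 < val l x * (val (flip l) (inv x) * conv G ?fs (inv (inv x) \<otimes> (inv x \<otimes> \<one>)))"
    using Suc x by (simp add: val)
  also have "\<dots> \<le> val l x * conv G (val (flip l) # ?fs) (inv x \<otimes> \<one>)"
    using x by (intro mult_left_mono conv_Cons_ge fin nonneg') auto
  also have "\<dots> \<le> conv G (val l # val (flip l) # ?fs) \<one>"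
    using x by (intro conv_Cons_ge fin nonneg') auto
  finally show ?case unfolding eq .
qed

end

section \<open>The alternating product as a convolution\<close>

text \<open>Adding one factor at a time, where \<open>alt_prod\<close> adds two, permits induction
  on the number of variables.\<close>

primrec signed_prod :: "('g, 'm) monoid_scheme \<Rightarrow> nat \<Rightarrow> (nat \<Rightarrow> 'g) \<Rightarrow> 'g" where
  "signed_prod G 0 a = \<one>\<^bsub>G\<^esub>"
| "signed_prod G (Suc n) a =
     signed_prod G n a \<otimes>\<^bsub>G\<^esub> (if even n then a (Suc n) else inv\<^bsub>G\<^esub> (a (Suc n)))"

lemma alt_prod_eq_signed_prod: "alt_prod G d a = signed_prod G (2 * d) a"
  by (induction d) auto

lemma signed_prod_cong:
  assumes "\<And>i. i \<in> {1..n} \<Longrightarrow> a i = b i"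
  shows "signed_prod G n a = signed_prod G n b"
  using assms by (induction n) auto

lemma sum_PiE_atLeastAtMost_Suc:
  "(\<Sum>a\<in>{1..Suc n} \<rightarrow>\<^sub>E S. F a) = (\<Sum>y\<in>S. \<Sum>a\<in>{1..n} \<rightarrow>\<^sub>E S. F (a(Suc n := y)))"
proof -
  have "{1..Suc n} = insert (Suc n) {1..n}" by auto
  then have "(\<Sum>a\<in>{1..Suc n} \<rightarrow>\<^sub>E S. F a) =
      (\<Sum>a\<in>(\<lambda>(y, g). g(Suc n := y)) ` (S \<times> ({1..n} \<rightarrow>\<^sub>E S)). F a)"
    by (simp add: PiE_insert_eq)
  also have "\<dots> = (\<Sum>(y, a)\<in>S \<times> ({1..n} \<rightarrow>\<^sub>E S). F (a(Suc n := y)))"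
    by (subst sum.reindex[OF inj_combinator]) (auto simp: case_prod_unfold)
  also have "\<dots> = (\<Sum>y\<in>S. \<Sum>a\<in>{1..n} \<rightarrow>\<^sub>E S. F (a(Suc n := y)))"
    by (rule sum.cartesian_product[symmetric])
  finally show ?thesis .
qed

context group
begin

lemma signed_prod_closed:
  assumes "\<And>i. i \<in> {1..n} \<Longrightarrow> a i \<in> carrier G"
  shows "signed_prod G n a \<in> carrier G"
  using assms by (induction n) auto

text \<open>The inverses at even positions are absorbed into the weights. Arbitrary \<open>g\<close>
  is needed because splitting off the last factor changes the target.\<close>

lemma sum_signed_prod_eq_conv:
  assumes fin: "finite (carrier G)" and g: "g \<in> carrier G"
  shows "(\<Sum>a\<in>{1..n} \<rightarrow>\<^sub>E carrier G. (\<Prod>i\<in>{1..n}. w i (a i)) * of_bool (signed_prod G n a = g)) =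
    conv G (map (\<lambda>i. if even i then \<lambda>x. w i (inv x) else w i) [1..<Suc n]) g"
  using g
proof (induction n arbitrary: g)
  case 0
  then show ?case by (simp add: eq_commute)
next
  case (Suc n)
  define fs where "fs = map (\<lambda>i. if even i then \<lambda>x. w i (inv x) else w i) [1..<Suc n]"
  define f where "f = (if even (Suc n) then \<lambda>x. w (Suc n) (inv x) else w (Suc n))"
  \<comment> \<open>The factor that \<open>y\<close> contributes at position \<open>Suc n\<close>,
    which is odd exactly when \<open>n\<close> is even.\<close>
  define s where "s y = (if even n then y else inv y)" for y
  have s: "s y \<in> carrier G" "s (s y) = y" "f (s y) = w (Suc n) y" if "y \<in> carrier G" for y
    using that by (auto simp: s_def f_def)
  have "(\<Sum>a\<in>{1..Suc n} \<rightarrow>\<^sub>E carrier G.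
        (\<Prod>i\<in>{1..Suc n}. w i (a i)) * of_bool (signed_prod G (Suc n) a = g)) =
      (\<Sum>y\<in>carrier G. conv G fs (g \<otimes> inv (s y)) * f (s y))"
    unfolding sum_PiE_atLeastAtMost_Suc
  proof (rule sum.cong[OF HOL.refl])
    fix y assume y: "y \<in> carrier G"
    have "(\<Sum>a\<in>{1..n} \<rightarrow>\<^sub>E carrier G. (\<Prod>i\<in>{1..Suc n}. w i ((a(Suc n := y)) i)) *
          of_bool (signed_prod G (Suc n) (a(Suc n := y)) = g)) =
        (\<Sum>a\<in>{1..n} \<rightarrow>\<^sub>E carrier G. (\<Prod>i\<in>{1..n}. w i (a i)) *
          of_bool (signed_prod G n a = g \<otimes> inv (s y)) * f (s y))"
    proof (rule sum.cong[OF HOL.refl])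
      fix a assume a: "a \<in> {1..n} \<rightarrow>\<^sub>E carrier G"
      have closed: "signed_prod G n a \<in> carrier G"
        using a by (intro signed_prod_closed) auto
      have "signed_prod G n (a(Suc n := y)) = signed_prod G n a"
        by (rule signed_prod_cong) auto
      then have "signed_prod G (Suc n) (a(Suc n := y)) = g \<longleftrightarrow> signed_prod G n a \<otimes> s y = g"
        by (simp add: s_def)
      also have "\<dots> \<longleftrightarrow> signed_prod G n a = g \<otimes> inv (s y)"
        using closed s(1)[OF y] Suc.prems by (metis inv_solve_right)
      finally have "signed_prod G (Suc n) (a(Suc n := y)) = g \<longleftrightarrow>
          signed_prod G n a = g \<otimes> inv (s y)" .
      moreover have "(\<Prod>i\<in>{1..Suc n}. w i ((a(Suc n := y)) i)) =
          (\<Prod>i\<in>{1..n}. w i (a i)) * f (s y)"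
        using s(3)[OF y] by simp
      ultimately show "(\<Prod>i\<in>{1..Suc n}. w i ((a(Suc n := y)) i)) *
          of_bool (signed_prod G (Suc n) (a(Suc n := y)) = g) =
          (\<Prod>i\<in>{1..n}. w i (a i)) * of_bool (signed_prod G n a = g \<otimes> inv (s y)) * f (s y)"
        by (simp only: mult.assoc mult.commute mult.left_commute)
    qed
    also have "\<dots> = conv G fs (g \<otimes> inv (s y)) * f (s y)"
      unfolding fs_def
      by (subst Suc.IH[symmetric]) (use Suc.prems s(1)[OF y] in \<open>auto simp: sum_distrib_right\<close>)
    finally show "(\<Sum>a\<in>{1..n} \<rightarrow>\<^sub>E carrier G. (\<Prod>i\<in>{1..Suc n}. w i ((a(Suc n := y)) i)) *
        of_bool (signed_prod G (Suc n) (a(Suc n := y)) = g)) = \<dots>" .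
  qed
  also have "\<dots> = (\<Sum>y\<in>carrier G. conv G fs (g \<otimes> inv y) * f y)"
    by (rule sum.reindex_bij_witness[where i = s and j = s]) (auto simp: s)
  \<comment> \<open>The new variable \<open>x\<close> is the product of the first \<open>n\<close>
    factors.\<close>
  also have "\<dots> = (\<Sum>x\<in>carrier G. conv G fs x * f (inv x \<otimes> g))"
    by (rule sum.reindex_bij_witness[where i = "\<lambda>x. inv x \<otimes> g" and j = "\<lambda>y. g \<otimes> inv y"])
       (use Suc.prems in \<open>auto simp: inv_mult_group m_assoc mult_inv_mult_cancel\<close>)
  also have "\<dots> = conv G (fs @ [f]) g"
    using Suc.prems by (simp add: conv_append[OF fin] conv_singleton[OF fin] del: conv.simps)
  also have "fs @ [f] = map (\<lambda>i. if even i then \<lambda>x. w i (inv x) else w i) [1..<Suc (Suc n)]"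
    by (simp add: fs_def f_def)
  finally show ?case .
qed

lemma S2_eq_conv:
  assumes "finite (carrier G)"
  shows "S2 G d w =
    conv G (map (\<lambda>i. if even i then \<lambda>x. w i (inv x) else w i) [1..<Suc (2 * d)]) \<one>"
proof -
  have "finite ({1..2 * d} \<rightarrow>\<^sub>E carrier G)" using assms by (intro finite_PiE) auto
  then show ?thesis
    unfolding S2_def alt_prod_eq_signed_prod
    using sum_signed_prod_eq_conv[OF assms, of \<one> w "2 * d"] by simp
qed

end

section \<open>From the chessboard estimate to the inequality for \<open>S2\<close>\<close>

theorem theorem1p4:
  fixes G :: "('g, 'm) monoid_scheme"
    and d :: nat
    and w :: "nat \<Rightarrow> 'g \<Rightarrow> real"
  assumes "d \<ge> 1"
    and "group G"
    and "finite (carrier G)"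
    and "\<And>i x. i \<in> {1..2 * d} \<Longrightarrow> x \<in> carrier G \<Longrightarrow> w i x \<ge> 0"
    and "\<And>i. i \<in> {1..2 * d} \<Longrightarrow> {x \<in> carrier G. w i x \<noteq> 0} \<noteq> {}"
  shows "S2 G d w \<le> (\<Prod>i\<in>{1..2 * d}. S2 G d (\<lambda>_. w i) powr (1 / (2 * real d)))"
proof -
  interpret group G by fact
  note fin = assms(3)
  \<comment> \<open>The label \<open>(i, b)\<close> stands for \<open>w\<^sub>i\<close>, composed with inversion if \<open>b\<close> holds. Labels make
    \<open>flip\<close> an involution, which inversion of functions is only on the carrier.\<close>
  define val where "val = (\<lambda>(i, b) x. w i (if b then inv\<^bsub>G\<^esub> x else x))"
  define flip :: "nat \<times> bool \<Rightarrow> nat \<times> bool" where "flip = (\<lambda>(i, b). (i, \<not> b))"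
  have flip_pair: "flip (i, b) = (i, \<not> b)" for i b by (simp add: flip_def)
  define L where "L = {1..2 * d} \<times> (UNIV :: bool set)"
  define T where "T u = conv G (map val u) \<one>\<^bsub>G\<^esub>" for u
  define A where "A l = T (alternating flip (2 * d) l)" for l
  \<comment> \<open>Even positions carry the inverted weights, so \<open>T u\<close> will be
    \<open>S2 G d w\<close>.\<close>
  define u where "u = map (\<lambda>i. (i, even i)) [1..<Suc (2 * d)]"
  have flip: "flip (flip l) = l" for l by (simp add: flip_def case_prod_unfold)
  have val: "val (flip l) x = val l (inv\<^bsub>G\<^esub> x)" if "x \<in> carrier G" for l x
    using that by (auto simp: val_def flip_def case_prod_unfold)
  have nonneg: "val l x \<ge> 0" if "l \<in> L" "x \<in> carrier G" for l x
    using that assms(4) by (auto simp: val_def L_def)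
  have rot: "T (rotate1 v) = T v" for v
    using conv_append_one_commute[OF fin, of "map val (tl v)" "[val (hd v)]"]
    by (cases v) (auto simp: T_def simp del: conv.simps)
  have A_pos: "A l > 0" if "l \<in> L" for l
  proof -
    obtain i b where "l = (i, b)" by (cases l)
    with that have l: "l = (i, b)" "i \<in> {1..2 * d}" by (simp_all add: L_def)
    then obtain x where x: "x \<in> carrier G" "w i x \<noteq> 0" using assms(5) by blast
    then have "w i x > 0" using assms(4) l(2) by (simp add: less_le)
    then have "val l (if b then inv\<^bsub>G\<^esub> x else x) > 0" using x l by (simp add: val_def)
    then show ?thesis unfolding A_def T_def
      by (intro conv_alternating_pos fin flip val nonneg that) (use x in auto)
  qed
  have A_flip: "A (flip l) = A l" for l
    unfolding A_def by (metis rot rotate1_alternating flip)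
  \<comment> \<open>The first weight has the odd index 1, hence the alternating word starts with the
    label that is not inverted.\<close>
  have S2_A: "S2 G d (\<lambda>_. w i) = A (i, False)" for i
  proof -
    have "map (\<lambda>j. if even j then \<lambda>x. w i (inv\<^bsub>G\<^esub> x) else w i) [1..<Suc (2 * d)] =
        map val (alternating flip (2 * d) (i, False))"
      by (rule nth_equalityI)
         (auto simp: alternating_def funpow_involution flip val_def flip_pair fun_eq_iff
           simp del: upt_Suc)
    then show ?thesis unfolding S2_eq_conv[OF fin] A_def T_def by simp
  qed
  \<comment> \<open>Rotation by one exchanges the two possible starting labels.\<close>
  have A_i: "A (i, b) = S2 G d (\<lambda>_. w i)" for i b
    using A_flip[of "(i, False)"] by (cases b) (auto simp: flip_def S2_A)
  have "map (\<lambda>i. if even i then \<lambda>x. w i (inv\<^bsub>G\<^esub> x) else w i) [1..<Suc (2 * d)] = map val u"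
    by (auto simp: u_def val_def fun_eq_iff simp del: upt_Suc)
  then have S2_T: "S2 G d w = T u" unfolding S2_eq_conv[OF fin] T_def by simp
  have T_nonneg: "T v \<ge> 0" if "set v \<subseteq> L" for v
    unfolding T_def by (rule conv_nonneg) (use that nonneg in auto)
  have uL: "set u \<subseteq> L" by (auto simp: u_def L_def simp del: upt_Suc)
  have "T u ^ (2 * d) \<le> prod_list (map A u)"
    unfolding A_def
  proof (rule chessboard[where L = L])
    show "finite L" by (simp add: L_def)
    show "flip l \<in> L" if "l \<in> L" for l using that by (auto simp: L_def flip_def)
    show "T (xs @ ys) ^ 2 \<le> T (xs @ map flip (rev xs)) * T (map flip (rev ys) @ ys)" for xs ys
      unfolding T_def by (rule conv_Cauchy_Schwarz) (use fin val in auto)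
    show "T (alternating flip (2 * d) l) > 0" if "l \<in> L" for l
      using A_pos[OF that] by (simp add: A_def)
    show "length u = 2 * d" by (simp add: u_def)
  qed (use assms(1) flip T_nonneg rot uL in auto)
  also have "prod_list (map A u) = (\<Prod>i\<in>{1..2 * d}. S2 G d (\<lambda>_. w i))"
  proof -
    have "map A u = map (\<lambda>i. S2 G d (\<lambda>_. w i)) [1..<Suc (2 * d)]"
      by (auto simp: u_def A_i simp del: upt_Suc)
    then show ?thesis
      by (simp add: prod.distinct_set_conv_list[symmetric] atLeastLessThanSuc_atLeastAtMost
          del: upt_Suc)
  qed
  finally have le: "T u ^ (2 * d) \<le> (\<Prod>i\<in>{1..2 * d}. S2 G d (\<lambda>_. w i))" .
  \<comment> \<open>The value 0 is treated apart: \<open>powr_realpow\<close> needs a positive base,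
    while \<open>0 powr\<close> any exponent is 0.\<close>
  have "T u = (T u ^ (2 * d)) powr (1 / (2 * real d))"
  proof (cases "T u = 0")
    case False
    then have "T u > 0" using T_nonneg[OF uL] by simp
    then show ?thesis using assms(1) by (simp add: powr_realpow[symmetric] powr_powr)
  qed (use assms(1) in auto)
  also have "\<dots> \<le> (\<Prod>i\<in>{1..2 * d}. S2 G d (\<lambda>_. w i)) powr (1 / (2 * real d))"
    by (rule powr_mono2) (use le T_nonneg[OF uL] in auto)
  also have "\<dots> = (\<Prod>i\<in>{1..2 * d}. S2 G d (\<lambda>_. w i) powr (1 / (2 * real d)))"
    by (rule prod_powr_distrib)
  finally show ?thesis unfolding S2_T .
qed

end
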